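(* A function $u:\mathbb{Z}\times\mathbb{Z}\to\mathbb{C}$ is a solution to the discrete wave equation $$u(n,t+1)+u(n,t-1)=u(n+1,t)+u(n-1,t)\qquad(n,t\in\mathbb{Z})$$ if and only if it can be written as $$u(n,t)=w_\infty(n-t)+w_{-\infty}(n+t)$$ for some $w_\infty,w_{-\infty}:\mathbb{Z}\to\mathbb{C}$. Moreover, if $w_\infty(n-t)+w_{-\infty}(n+t)=\tilde w_\infty(n-t)+\tilde w_{-\infty}(n+t)$ for all $n,t\in\mathbb{Z}$, then $$w_\infty(n-t)-\tilde w_\infty(n-t)=\tilde w_{-\infty}(n+t)-w_{-\infty}(n+t)$$ is a function of $(n,t)$ which is constant on $\{n+t\equiv0\bmod2\}$ and constant on $\{n+t\equiv1\bmod2\}$. *)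

theory Defs
  imports "HOL-Analysis.Analysis" "HOL-Number_Theory.Cong"
begin

definition discrete_wave_solution :: "(int \<Rightarrow> int \<Rightarrow> complex) \<Rightarrow> bool" where
  "discrete_wave_solution u \<longleftrightarrow>
     (\<forall>n t. u n (t + 1) + u n (t - 1) = u (n + 1) t + u (n - 1) t)"

end

theory Submission
  imports Defs
begin

text \<open>
  Rearranged as \<open>u(n, t + 1) - u(n - 1, t) = u(n + 1, t) - u(n, t - 1)\<close>, the wave equation says
  that the diagonal increment \<open>u(n + 1, t + 1) - u(n, t)\<close> does not change along the antidiagonals,
  so that it is a function of \<open>n + t\<close> only. If \<open>w(k + 2) - w(k)\<close> is this increment for \<open>n + t = k\<close>,
  then \<open>w(n + t)\<close> has the same diagonal increments as \<open>u\<close>, hence \<open>u(n, t) - w(n + t)\<close> is invariant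
  under \<open>(n, t) \<mapsto> (n + 1, t + 1)\<close> and depends on \<open>n - t\<close> only. Such a \<open>w\<close> can be read off from \<open>u\<close>:
  take its values along a staircase that meets every antidiagonal once and is invariant under
  the diagonal shift (\<open>discrete_wave_decomposition\<close>). Conversely, for \<open>w(n - t) + w'(n + t)\<close> both
  sides of the wave equation add up the values of \<open>w\<close> at \<open>n - t \<plusminus> 1\<close> and of \<open>w'\<close> at \<open>n + t \<plusminus> 1\<close>.

  For uniqueness, a function of \<open>n - t\<close> that is also a function of \<open>n + t\<close> takes the same value
  at \<open>i = n - t\<close> as the other does at \<open>j = n + t\<close>, and here \<open>i\<close> and \<open>j\<close> are arbitrary integers
  of equal parity (\<open>eq_at_same_parity\<close>).
\<close>

lemma int_shift_invariant_imp_const: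
  fixes f :: "int \<Rightarrow> 'a"
  assumes step: "\<And>x. f (x + 1) = f x"
  shows "f x = f 0"
proof (induction x rule: int_induct[where k = 0])
  case (step2 i)
  then show ?case using step[of "i - 1"] by simp
qed (simp_all add: step)

text \<open>The two lemmas below are the discrete form of "a function with vanishing derivative in a
  characteristic direction depends on the other characteristic variable only".\<close>

lemma diagonal_invariant:
  fixes v :: "int \<Rightarrow> int \<Rightarrow> 'a"
  assumes "\<And>n t. v (n + 1) (t + 1) = v n t"
  shows "v n t = v (n - t) 0"
  using int_shift_invariant_imp_const[of "\<lambda>s. v (n - t + s) s" t] assms
  by (simp flip: add.assoc)

lemma antidiagonal_invariant:
  fixes v :: "int \<Rightarrow> int \<Rightarrow> 'a"
  assumes "\<And>n t. v n (t + 1) = v (n + 1) t"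
  shows "v n t = v (n + t) 0"
  using diagonal_invariant[of "\<lambda>n t. v n (- t)" n "- t"] assms[of _ "- _ - 1"]
  by simp

lemma travelling_waves_solve:
  "discrete_wave_solution (\<lambda>n t. w (n - t) + w' (n + t))"
  by (simp add: discrete_wave_solution_def algebra_simps)

text \<open>This is the wave equation factored into two first-order equations: the increments along
  one characteristic direction are transported along the other, down to the line \<open>t = 0\<close>.\<close>

lemma discrete_wave_diagonal_increment:
  assumes "discrete_wave_solution u"
  shows "u (n + 1) (t + 1) - u n t = u (n + t + 1) 1 - u (n + t) 0"
proof -
  have "u (n + 1) (t + 1 + 1) - u n (t + 1) = u (n + 1 + 1) (t + 1) - u (n + 1) t" for n t
  proof -
    have "u (n + 1) (t + 1 + 1) + u (n + 1) (t + 1 - 1)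
        = u (n + 1 + 1) (t + 1) + u (n + 1 - 1) (t + 1)"
      using assms unfolding discrete_wave_solution_def by blast
    then show ?thesis by (simp add: algebra_simps)
  qed
  from antidiagonal_invariant[of "\<lambda>n t. u (n + 1) (t + 1) - u n t", OF this]
  show ?thesis by simp
qed

text \<open>The part \<open>w'\<close> is an antidifference, with step two, of the diagonal increments.\<close>

lemma discrete_wave_decomposition:
  assumes "discrete_wave_solution u"
  obtains w w' where "\<And>n t. u n t = w (n - t) + w' (n + t)"
proof -
  \<comment> \<open>The points \<open>(k - k div 2, k div 2)\<close> form the staircase: the coordinates sum to \<open>k\<close>,
    and replacing \<open>k\<close> by \<open>k + 2\<close> increases both of them by one.\<close>
  define w' where "w' k = u (k - k div 2) (k div 2)" for k
  have incr: "w' (k + 2) - w' k = u (k + 1) 1 - u k 0" for k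
  proof -
    have "w' (k + 2) = u (k - k div 2 + 1) (k div 2 + 1)"
      by (simp add: w'_def algebra_simps)
    then show ?thesis
      using discrete_wave_diagonal_increment[OF assms, of "k - k div 2" "k div 2"]
      by (simp add: w'_def)
  qed
  define v where "v n t = u n t - w' (n + t)" for n t
  have "v (n + 1) (t + 1) = v n t" for n t
  proof -
    have "n + 1 + (t + 1) = n + t + 2" by simp
    then have "w' (n + 1 + (t + 1)) - w' (n + t) = u (n + 1) (t + 1) - u n t"
      by (simp only: incr discrete_wave_diagonal_increment[OF assms, of n t])
    then show ?thesis
      by (simp add: v_def algebra_simps)
  qed
  then have v: "v n t = v (n - t) 0" for n t
    by (rule diagonal_invariant)
  have "u n t = v (n - t) 0 + w' (n + t)" for n t
    using v[of n t] by (simp add: v_def diff_eq_eq)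
  then show thesis by (rule that)
qed

text \<open>The system \<open>n - t = i\<close>, \<open>n + t = j\<close> has an integer solution exactly when \<open>i\<close> and \<open>j\<close> have
  the same parity; this is where the two parity classes come from.\<close>

lemma eq_at_same_parity:
  fixes p q :: "int \<Rightarrow> 'a"
  assumes "\<And>n t. p (n - t) = q (n + t)" and "[i = j] (mod 2)"
  shows "p i = q j"
proof -
  obtain m where "i = j + 2 * m"
    using cong_sym[OF assms(2)] cong_iff_lin[of j i 2] by blast
  then show ?thesis
    using assms(1)[of "j + m" "- m"] by (simp add: algebra_simps)
qed

lemma difference_constant_on_parity_class:
  fixes p q :: "int \<Rightarrow> 'a"
  assumes "\<And>n t. p (n - t) = q (n + t)"
  shows "(\<lambda>(n, t). p (n - t)) constant_on {(n, t). [n + t = r] (mod 2)}"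
proof -
  have "p (n - t) = p r" if "[n + t = r] (mod 2)" for n t
    using assms[of n t] eq_at_same_parity[of p q, OF assms cong_sym[OF that]]
    by simp
  then show ?thesis
    unfolding constant_on_def by auto
qed

theorem corollary2p6:
  shows "(\<forall>u :: int \<Rightarrow> int \<Rightarrow> complex.
            discrete_wave_solution u \<longleftrightarrow>
            (\<exists>(w_inf :: int \<Rightarrow> complex) (w_minf :: int \<Rightarrow> complex).
               \<forall>n t. u n t = w_inf (n - t) + w_minf (n + t)))
       \<and> (\<forall>(w_inf :: int \<Rightarrow> complex) (w_minf :: int \<Rightarrow> complex)
            (w_inf' :: int \<Rightarrow> complex) (w_minf' :: int \<Rightarrow> complex).
            (\<forall>n t. w_inf (n - t) + w_minf (n + t) = w_inf' (n - t) + w_minf' (n + t)) \<longrightarrow>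
              (\<forall>n t. w_inf (n - t) - w_inf' (n - t) = w_minf' (n + t) - w_minf (n + t))
            \<and> (\<lambda>(n, t). w_inf (n - t) - w_inf' (n - t)) constant_on {(n, t). [n + t = 0] (mod 2)}
            \<and> (\<lambda>(n, t). w_inf (n - t) - w_inf' (n - t)) constant_on {(n, t). [n + t = 1] (mod 2)})"
proof (intro conjI allI impI)
  fix u :: "int \<Rightarrow> int \<Rightarrow> complex"
  show "discrete_wave_solution u \<longleftrightarrow> (\<exists>w w'. \<forall>n t. u n t = w (n - t) + w' (n + t))"
  proof
    assume "discrete_wave_solution u"
    then show "\<exists>w w'. \<forall>n t. u n t = w (n - t) + w' (n + t)"
      by (metis discrete_wave_decomposition)
  next
    assume "\<exists>w w'. \<forall>n t. u n t = w (n - t) + w' (n + t)"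
    then obtain w w' where "u = (\<lambda>n t. w (n - t) + w' (n + t))" by blast
    then show "discrete_wave_solution u" by (simp add: travelling_waves_solve)
  qed
next
  fix w v w' v' :: "int \<Rightarrow> complex"
  assume eq: "\<forall>n t. w (n - t) + v (n + t) = w' (n - t) + v' (n + t)"
  show diff: "w (n - t) - w' (n - t) = v' (n + t) - v (n + t)" for n t
    using eq[rule_format, of n t] by (simp add: algebra_simps)
  note const = difference_constant_on_parity_class
    [of "\<lambda>k. w k - w' k" "\<lambda>k. v' k - v k", OF diff]
  show "(\<lambda>(n, t). w (n - t) - w' (n - t)) constant_on {(n, t). [n + t = 0] (mod 2)}"
    by (rule const)
  show "(\<lambda>(n, t). w (n - t) - w' (n - t)) constant_on {(n, t). [n + t = 1] (mod 2)}"
    by (rule const)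
qed

end
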